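(* Consider an instance of the problem $1|pmtn; r_j, p_j|F(C_j)$ with integer release times $r_j$, integer processing times $p_j$, and an objective function $F$ that is an increasing function of the completion times. Let $i\ne j$ be two jobs. In an optimal schedule, if job $i$ is partially processed between two processing intervals of job $j$ (i.e. a positive amount of $i$'s processing takes place after the earlier and before the later of these two intervals), then job $i$ is fully processed between these two intervals (i.e. all of its processing takes place after the earlier and before the later of them).
   Context: The problem $1|pmtn; r_j, p_j|F(C_j)$: there are $n$ jobs $1,\dots,n$ to be processed on a single machine, which can process at most one job at each point in time. Job $j$ has an integer release time $r_j\ge 0$ and a positive integer processing time $p_j$. Job $j$ becomes available for processing at the moment $r_j$ (it cannot be processed before time $r_j$) and must be processed for a total time of $p_j$. Preemptions of one job in favor of another are allowed at any (real) time and any (finite) number of times. A schedule specifies which job is processed when: job $j$ is processed on a finite union of intervals of the form $(a,b]$ of real time, and the sets for different jobs are disjoint. It is feasible if no job is processed before its release time and each job $j$ is processed for exactly $p_j$ time. A processing interval of job $j$ is a time interval of positive length throughout which $j$ is processed. The completion time $C_j$ of job $j$ is the earliest point in time at which it has been processed for $p_j$ time. The objective $F=F(C_1,\dots,C_n)$ is increasing in the completion times: if $C_j\le C_j'$ for all $j$ with strict inequality for at least one $j$, then $F(C_1,\dots,C_n)<F(C_1',\dots,C_n')$. A schedule is optimal if it is feasible and minimizes $F$ among all feasible schedules. Standing assumption: optimal schedules contain no idle time, i.e. with $T=\sum_{j=1}^n p_j$ and time measured from the start of processing, the machine is busy throughout $(0,T]$. *)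

theory Defs
  imports "HOL-Analysis.Analysis"
begin

text \<open>
  Jobs are the elements of a finite type \<open>'n\<close>.  A schedule maps each job to the set of times
  at which it is processed; a time \<open>t\<close> in this set stands for processing immediately up to \<open>t\<close>,
  which is why processing periods have the form \<open>{a<..b}\<close>.
\<close>

type_synonym 'n schedule = "'n \<Rightarrow> real set"

definition is_schedule :: "'n schedule \<Rightarrow> bool" where
  "is_schedule s \<longleftrightarrow>
     (\<forall>j. \<exists>P :: (real \<times> real) set. finite P \<and> s j = (\<Union>(a, b)\<in>P. {a<..b})) \<and>
     (\<forall>i j. i \<noteq> j \<longrightarrow> s i \<inter> s j = {})"

definition feasible :: "('n \<Rightarrow> nat) \<Rightarrow> ('n \<Rightarrow> nat) \<Rightarrow> 'n schedule \<Rightarrow> bool" where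
  "feasible r p s \<longleftrightarrow>
     is_schedule s \<and>
     (\<forall>j. s j \<subseteq> {real (r j)<..} \<and> measure lborel (s j) = real (p j))"

definition completion_time :: "('n \<Rightarrow> nat) \<Rightarrow> 'n schedule \<Rightarrow> 'n \<Rightarrow> real" where
  "completion_time p s j = (LEAST t. measure lborel (s j \<inter> {..t}) = real (p j))"

text \<open>
  Monotonicity is only required on vectors of completion times of feasible schedules, so that
  objectives such as \<open>\<Sum>j. (C j - r j)\<^sup>2\<close>, which are not increasing on all real vectors, are included.
\<close>

definition increasing_objective ::
    "('n \<Rightarrow> nat) \<Rightarrow> ('n \<Rightarrow> nat) \<Rightarrow> (('n \<Rightarrow> real) \<Rightarrow> real) \<Rightarrow> bool" where
  "increasing_objective r p F \<longleftrightarrow>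
     (\<forall>s s'. feasible r p s \<longrightarrow> feasible r p s' \<longrightarrow>
        (\<forall>j. completion_time p s j \<le> completion_time p s' j) \<longrightarrow>
        (\<exists>j. completion_time p s j < completion_time p s' j) \<longrightarrow>
        F (completion_time p s) < F (completion_time p s'))"

definition optimal ::
    "('n \<Rightarrow> nat) \<Rightarrow> ('n \<Rightarrow> nat) \<Rightarrow> (('n \<Rightarrow> real) \<Rightarrow> real) \<Rightarrow> 'n schedule \<Rightarrow> bool" where
  "optimal r p F s \<longleftrightarrow>
     feasible r p s \<and>
     (\<forall>s'. feasible r p s' \<longrightarrow> F (completion_time p s) \<le> F (completion_time p s'))"

text \<open>The start of processing \<open>t0\<close> is kept explicit instead of being shifted to \<open>0\<close>.\<close>

definition no_idle_time :: "('n::finite \<Rightarrow> nat) \<Rightarrow> 'n schedule \<Rightarrow> bool" where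
  "no_idle_time p s \<longleftrightarrow> (\<exists>t0. (\<Union>j. s j) = {t0<..t0 + (\<Sum>j\<in>UNIV. real (p j))})"

definition processing_interval :: "'n schedule \<Rightarrow> 'n \<Rightarrow> real \<Rightarrow> real \<Rightarrow> bool" where
  "processing_interval s j a b \<longleftrightarrow> a < b \<and> {a<..b} \<subseteq> s j"

end

theory Submission
  imports Defs
begin

text \<open>
  The idea is an exchange argument.  Suppose job \<open>k\<close> completes before job \<open>l\<close>, and \<open>l\<close> is
  processed on an interval that lies before the completion time of \<open>k\<close> and after the release of
  \<open>k\<close>.  Trade a short initial piece of that interval for the last piece of \<open>k\<close> of the same
  length.  Then \<open>k\<close> completes strictly earlier, while \<open>l\<close>, which still has its own final piece
  after the traded ones, completes when it did before.  No other job is affected, so the schedule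
  was not optimal.  This is \<open>earlier_completing_job_has_priority\<close>: in an optimal schedule, the job
  of two that completes first is never made to wait for the other once it is released.

  Now let \<open>i\<close> be processed between two intervals of \<open>j\<close>.  If \<open>j\<close> completed before \<open>i\<close>, then \<open>j\<close>,
  released but not yet complete, would wait for \<open>i\<close>'s piece in the middle.  So \<open>i\<close> completes first.  If
  \<open>i\<close> were processed before the earlier interval of \<open>j\<close>, it would be waiting during that interval;
  if it were processed after the later one, it would be waiting during the later one.
\<close>

section \<open>Finite unions of half-open intervals\<close>

text \<open>
  Every processing set of a schedule has this shape, and trading intervals between two jobs
  preserves it.
\<close>

definition half_open_union :: "real set \<Rightarrow> bool" where
  "half_open_union A \<longleftrightarrow> (\<exists>P :: (real \<times> real) set. finite P \<and> A = (\<Union>(a, b)\<in>P. {a<..b}))"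

lemma half_open_union_interval: "half_open_union {x<..y}"
  unfolding half_open_union_def by (rule exI[of _ "{(x, y)}"]) simp

lemma half_open_union_Un:
  assumes "half_open_union A" "half_open_union B"
  shows "half_open_union (A \<union> B)"
proof -
  obtain P Q where "finite P" "A = (\<Union>(a, b)\<in>P. {a<..b})" "finite Q" "B = (\<Union>(a, b)\<in>Q. {a<..b})"
    using assms unfolding half_open_union_def by blast
  then show ?thesis
    unfolding half_open_union_def by (intro exI[of _ "P \<union> Q"]) auto
qed

lemma half_open_union_UN:
  assumes "finite Q" "\<And>q. q \<in> Q \<Longrightarrow> half_open_union (f q)"
  shows "half_open_union (\<Union>q\<in>Q. f q)"
  using assms
proof (induction Q rule: finite_induct)
  case empty
  then show ?case unfolding half_open_union_def by (intro exI[of _ "{}"]) simp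
next
  case (insert q Q)
  then show ?case by (simp add: half_open_union_Un)
qed

lemma half_open_union_Diff_interval:
  assumes "half_open_union A"
  shows "half_open_union (A - {x<..y})"
proof -
  obtain P where P: "finite P" "A = (\<Union>(a, b)\<in>P. {a<..b})"
    using assms unfolding half_open_union_def by blast
  have "{a<..b} - {x<..y} = {a<..min b x} \<union> {max a y<..b}" for a b :: real by auto
  moreover have "A - {x<..y} = (\<Union>(a, b)\<in>P. {a<..b} - {x<..y})"
    unfolding P(2) by auto
  ultimately have "A - {x<..y} = (\<Union>(a, b)\<in>P. {a<..min b x} \<union> {max a y<..b})"
    by simp
  with P(1) show ?thesis
    by (auto intro!: half_open_union_UN half_open_union_Un half_open_union_interval)
qed

lemma half_open_union_fmeasurable:
  assumes "half_open_union A"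
  shows "A \<in> fmeasurable lborel"
proof -
  have "{a<..b} \<in> fmeasurable lborel" for a b :: real
    by (rule fmeasurableI) (cases "a \<le> b"; simp)+
  with assms show ?thesis
    unfolding half_open_union_def by (auto intro!: fmeasurable.finite_UN)
qed

lemma half_open_union_left_neighbourhood:
  assumes "half_open_union A" "t \<in> A" "x < t"
  obtains u where "x \<le> u" "u < t" "{u<..t} \<subseteq> A"
proof -
  obtain P where P: "A = (\<Union>(a, b)\<in>P. {a<..b})"
    using assms(1) unfolding half_open_union_def by blast
  with assms(2) obtain a b where "(a, b) \<in> P" "a < t" "t \<le> b" by auto
  then have "{max a x<..t} \<subseteq> A" unfolding P by (intro subsetI UN_I[of "(a, b)"]) auto
  with \<open>a < t\<close> \<open>x < t\<close> that[of "max a x"] show thesis by simp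
qed

text \<open>Closedness on the right is what makes the supremum an element.\<close>

lemma half_open_union_has_max:
  assumes "half_open_union A" "A \<noteq> {}"
  obtains m where "m \<in> A" "A \<subseteq> {..m}"
proof -
  obtain P where P: "finite P" "A = (\<Union>(a, b)\<in>P. {a<..b})"
    using assms(1) unfolding half_open_union_def by blast
  \<comment> \<open>Empty intervals must be left out: their right endpoints need not lie in the set.\<close>
  let ?E = "snd ` {q \<in> P. fst q < snd q}"
  have fin: "finite ?E" using P(1) by simp
  have "?E \<noteq> {}" using assms(2) unfolding P(2) by force
  then have "Max ?E \<in> ?E" using fin by (intro Max_in)
  then have "Max ?E \<in> A" unfolding P(2) by force
  moreover have "t \<le> Max ?E" if t: "t \<in> A" for t
  proof -
    from t obtain a b where ab: "(a, b) \<in> P" "a < t" "t \<le> b" unfolding P(2) by auto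
    then have "b \<in> ?E" by force
    then have "b \<le> Max ?E" using fin by (rule Max_ge[rotated])
    with ab show ?thesis by simp
  qed
  ultimately show thesis using that by blast
qed

section \<open>Feasible schedules and completion times\<close>

lemma feasible_iff:
  "feasible r p s \<longleftrightarrow>
     (\<forall>j. half_open_union (s j)) \<and> (\<forall>i j. i \<noteq> j \<longrightarrow> s i \<inter> s j = {}) \<and>
     (\<forall>j. s j \<subseteq> {real (r j)<..}) \<and> (\<forall>j. measure lborel (s j) = real (p j))"
  unfolding feasible_def is_schedule_def half_open_union_def by (simp add: all_conj_distrib)

lemma feasible_half_open_union: "feasible r p s \<Longrightarrow> half_open_union (s j)"
  by (simp add: feasible_iff)

lemma feasible_disjoint: "feasible r p s \<Longrightarrow> i \<noteq> j \<Longrightarrow> s i \<inter> s j = {}"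
  by (simp add: feasible_iff)

lemma feasible_released: "feasible r p s \<Longrightarrow> t \<in> s j \<Longrightarrow> real (r j) < t"
  by (auto simp: feasible_iff)

lemma feasible_measure: "feasible r p s \<Longrightarrow> measure lborel (s j) = real (p j)"
  by (simp add: feasible_iff)

lemma processing_interval_released:
  assumes "feasible r p s" "processing_interval s j u v"
  shows "real (r j) \<le> u"
proof (rule dense_ge_bounded[of u v])
  show "u < v" using assms(2) unfolding processing_interval_def by simp
  fix t assume "u < t" "t < v"
  then have "t \<in> s j" using assms(2) unfolding processing_interval_def by auto
  then show "real (r j) \<le> t" by (rule less_imp_le[OF feasible_released[OF assms(1)]])
qed

text \<open>
  Before its last instant, a job still lacks a left neighbourhood of that instant, which has
  positive length.
\<close>

lemma completion_time_eq_last: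
  assumes A: "half_open_union (s j)"
    and measure: "measure lborel (s j) = real (p j)"
    and last: "m \<in> s j" "s j \<subseteq> {..m}"
  shows "completion_time p s j = m"
  unfolding completion_time_def
proof (rule Least_equality)
  show "measure lborel (s j \<inter> {..m}) = real (p j)"
    using last(2) measure by (simp add: Int_absorb2)
next
  fix t assume t: "measure lborel (s j \<inter> {..t}) = real (p j)"
  show "m \<le> t"
  proof (rule ccontr)
    assume "\<not> m \<le> t"
    then have "t < m" by simp
    then obtain u where u: "t \<le> u" "u < m" "{u<..m} \<subseteq> s j"
      by (rule half_open_union_left_neighbourhood[OF A last(1)])
    note fm = half_open_union_fmeasurable[OF A]
    have 1: "s j \<inter> {..t} \<in> fmeasurable lborel"
      using fm by (intro fmeasurable_Int_fmeasurable) auto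
    have 2: "{u<..m} \<in> fmeasurable lborel"
      by (intro half_open_union_fmeasurable half_open_union_interval)
    have "measure lborel (s j \<inter> {..t}) + measure lborel {u<..m}
        = measure lborel (s j \<inter> {..t} \<union> {u<..m})"
      using 1 2 u(1) by (intro measure_Union[symmetric]) (auto simp: fmeasurable_def)
    also have "\<dots> \<le> measure lborel (s j)"
      using u(3) fm fmeasurableD[OF 1] fmeasurableD[OF 2]
      by (intro measure_mono_fmeasurable sets.Un) auto
    finally show False using t measure u(2) by simp
  qed
qed

lemma completion_time_last:
  assumes "feasible r p s" "0 < p j"
  shows completion_time_mem: "completion_time p s j \<in> s j"
    and completion_time_ge: "t \<in> s j \<Longrightarrow> t \<le> completion_time p s j"
proof -
  have hou: "half_open_union (s j)" by (rule feasible_half_open_union[OF assms(1)])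
  have ms: "measure lborel (s j) = real (p j)" by (rule feasible_measure[OF assms(1)])
  with assms(2) have "s j \<noteq> {}" by auto
  with hou obtain m where m: "m \<in> s j" "s j \<subseteq> {..m}" by (rule half_open_union_has_max)
  have "completion_time p s j = m" using hou ms m by (rule completion_time_eq_last)
  with m show "completion_time p s j \<in> s j" "t \<in> s j \<Longrightarrow> t \<le> completion_time p s j"
    by auto
qed

lemma completion_time_neq:
  assumes "feasible r p s" "0 < p i" "0 < p j" "i \<noteq> j"
  shows "completion_time p s i \<noteq> completion_time p s j"
  using completion_time_mem[OF assms(1,2)] completion_time_mem[OF assms(1,3)]
    feasible_disjoint[OF assms(1,4)] by auto

section \<open>Exchanging processing time between two jobs\<close>

lemma measure_exchange:
  assumes A: "A \<in> fmeasurable M" and B: "B \<in> fmeasurable M" and C: "C \<in> fmeasurable M"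
    and "B \<subseteq> A" "A \<inter> C = {}" "measure M B = measure M C"
  shows "measure M (A - B \<union> C) = measure M A"
proof -
  have AB: "A - B \<in> fmeasurable M" using A B by (rule fmeasurable.Diff)
  have "measure M (A - B \<union> C) = measure M (A - B) + measure M C"
    using AB C assms(5) by (intro measure_Union) (auto simp: fmeasurable_def)
  also have "measure M (A - B) = measure M A - measure M B"
    using A B assms(4) by (intro measure_Diff) (auto simp: fmeasurable_def)
  finally show ?thesis using assms(6) by simp
qed

definition exchange :: "'n schedule \<Rightarrow> 'n \<Rightarrow> 'n \<Rightarrow> real set \<Rightarrow> real set \<Rightarrow> 'n schedule" where
  "exchange s k l I J = s(k := s k - I \<union> J, l := s l - J \<union> I)"

lemma feasible_exchange:
  fixes x y u v :: real
  defines "I \<equiv> {x<..y}" and "J \<equiv> {u<..v}"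
  assumes feas: "feasible r p s" and "k \<noteq> l"
    and I: "I \<subseteq> s k" "I \<subseteq> {real (r l)<..}"
    and J: "J \<subseteq> s l" "J \<subseteq> {real (r k)<..}"
    and same_length: "measure lborel I = measure lborel J"
  shows "feasible r p (exchange s k l I J)"
proof -
  note hou = feasible_half_open_union[OF feas]
  note disj = feasible_disjoint[OF feas]
  have hI: "half_open_union I" and hJ: "half_open_union J"
    unfolding I_def J_def by (rule half_open_union_interval)+
  let ?s = "exchange s k l I J"
  have simps: "?s k = s k - I \<union> J" "?s l = s l - J \<union> I"
    "\<And>j. j \<noteq> k \<Longrightarrow> j \<noteq> l \<Longrightarrow> ?s j = s j"
    using \<open>k \<noteq> l\<close> unfolding exchange_def by auto
  have "half_open_union (s k - I \<union> J)" "half_open_union (s l - J \<union> I)"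
    using hou[of k] hou[of l] hI hJ unfolding I_def J_def
    by (auto intro: half_open_union_Un half_open_union_Diff_interval)
  then have hou': "half_open_union (?s j)" for j
    using simps hou by metis
  have "(s k - I \<union> J) \<inter> (s l - J \<union> I) = {}"
    using disj[OF \<open>k \<noteq> l\<close>] I(1) J(1) by blast
  moreover have "(s k - I \<union> J) \<inter> s j = {}" "(s l - J \<union> I) \<inter> s j = {}"
    if "j \<noteq> k" "j \<noteq> l" for j
    using disj[of k j] disj[of l j] that I(1) J(1) by blast+
  ultimately have disj': "?s j \<inter> ?s j' = {}" if "j \<noteq> j'" for j j'
    using that simps disj by (metis Int_commute)
  have rel': "?s j \<subseteq> {real (r j)<..}" for j
    using simps I(2) J(2) feasible_released[OF feas]
    by (cases "j = k"; cases "j = l") auto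
  have "measure lborel (s k - I \<union> J) = measure lborel (s k)"
    using I(1) J(1) disj[OF \<open>k \<noteq> l\<close>] same_length hou hI hJ
    by (intro measure_exchange half_open_union_fmeasurable) auto
  moreover have "measure lborel (s l - J \<union> I) = measure lborel (s l)"
    using I(1) J(1) disj[OF \<open>k \<noteq> l\<close>] same_length hou hI hJ
    by (intro measure_exchange half_open_union_fmeasurable) auto
  ultimately have "measure lborel (?s j) = real (p j)" for j
    using simps feasible_measure[OF feas] by metis
  with hou' disj' rel' show ?thesis
    by (simp add: feasible_iff)
qed

text \<open>
  Otherwise moving the end of \<open>k\<close> into the interval of \<open>l\<close> would let \<open>k\<close> complete earlier.  That \<open>l\<close>
  completes after \<open>k\<close> is what makes the trade free for \<open>l\<close>: the time it receives in return ends
  before its own last instant.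
\<close>

lemma earlier_completing_job_has_priority:
  assumes pos: "\<And>j. 0 < p j"
    and increasing: "increasing_objective r p F"
    and opt: "optimal r p F s"
    and first: "completion_time p s k < completion_time p s l"
    and l_interval: "processing_interval s l u v"
    and released: "real (r k) \<le> u"
  shows "completion_time p s k \<le> u"
proof (rule ccontr)
  let ?C = "completion_time p s"
  assume "\<not> ?C k \<le> u"
  then have waits: "u < ?C k" by simp
  have feas: "feasible r p s" using opt unfolding optimal_def by blast
  have "k \<noteq> l" using first by auto
  have uv: "u < v" "{u<..v} \<subseteq> s l" using l_interval unfolding processing_interval_def by auto
  have Ck: "?C k \<in> s k" and Cl: "?C l \<in> s l" using completion_time_mem[OF feas pos] by auto
  \<comment> \<open>The instant at which \<open>k\<close> completes belongs to \<open>k\<close>, so it is not inside the interval of \<open>l\<close>.\<close>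
  have "v < ?C k"
    using Ck uv waits feasible_disjoint[OF feas \<open>k \<noteq> l\<close>]
    by (metis disjoint_iff greaterThanAtMost_iff in_mono not_le)
  then obtain w where w: "v \<le> w" "w < ?C k" "{w<..?C k} \<subseteq> s k"
    by (rule half_open_union_left_neighbourhood[OF feasible_half_open_union[OF feas] Ck])
  \<comment> \<open>The traded length has to fit both the final stretch of \<open>k\<close> and the interval of \<open>l\<close>.\<close>
  define \<delta> where "\<delta> = min (?C k - w) (v - u)"
  have \<delta>: "0 < \<delta>" "\<delta> \<le> ?C k - w" "\<delta> \<le> v - u" using w uv unfolding \<delta>_def by auto
  define I where "I = {?C k - \<delta><..?C k}"
  define J where "J = {u<..u + \<delta>}"
  have I: "I \<subseteq> s k" using w \<delta> unfolding I_def by auto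
  have J: "J \<subseteq> s l" using uv \<delta> unfolding J_def by auto
  let ?s = "exchange s k l I J"
  have simps: "?s k = s k - I \<union> J" "?s l = s l - J \<union> I"
    "\<And>j. j \<noteq> k \<Longrightarrow> j \<noteq> l \<Longrightarrow> ?s j = s j"
    using \<open>k \<noteq> l\<close> unfolding exchange_def by auto
  have feas': "feasible r p ?s"
    unfolding I_def J_def
  proof (rule feasible_exchange[OF feas \<open>k \<noteq> l\<close>])
    show "{?C k - \<delta><..?C k} \<subseteq> {real (r l)<..}"
      using processing_interval_released[OF feas l_interval] w \<delta> uv by auto
    show "measure lborel {?C k - \<delta><..?C k} = measure lborel {u<..u + \<delta>}"
      using \<delta> by simp
  qed (use I J released in \<open>auto simp: I_def J_def\<close>)
  let ?C' = "completion_time p ?s"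
  have k_improves: "?C' k < ?C k"
  proof -
    have "?s k \<subseteq> {..?C k - \<delta>}"
      unfolding simps(1) using completion_time_ge[OF feas pos, of _ k] w \<delta> uv
      unfolding I_def J_def by force
    then have "?C' k \<le> ?C k - \<delta>" using completion_time_mem[OF feas' pos, of k] by auto
    with \<delta> show ?thesis by simp
  qed
  have l_unchanged: "?C' l = ?C l"
  proof (rule completion_time_eq_last)
    show "half_open_union (?s l)" by (rule feasible_half_open_union[OF feas'])
    show "measure lborel (?s l) = real (p l)" by (rule feasible_measure[OF feas'])
    show "?C l \<in> ?s l" unfolding simps(2) using Cl first \<delta> w uv unfolding J_def by auto
    show "?s l \<subseteq> {..?C l}"
      unfolding simps(2) using completion_time_ge[OF feas pos, of _ l] first
      unfolding I_def by force
  qed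
  have others_unchanged: "?C' j = ?C j" if "j \<noteq> k" "j \<noteq> l" for j
    unfolding completion_time_def simps(3)[OF that] ..
  have "\<forall>j. ?C' j \<le> ?C j"
    using k_improves l_unchanged others_unchanged by (metis less_imp_le order_refl)
  then have "F ?C' < F ?C"
    using increasing feas feas' k_improves unfolding increasing_objective_def by blast
  moreover have "F ?C \<le> F ?C'" using opt feas' unfolding optimal_def by blast
  ultimately show False by simp
qed

section \<open>Processing between two intervals of another job\<close>

theorem corollary2p1:
  fixes r p :: "'n::finite \<Rightarrow> nat"
    and F :: "('n \<Rightarrow> real) \<Rightarrow> real"
    and s :: "'n schedule"
    and i j :: 'n
    and a b c d :: real
  assumes p_pos: "\<forall>k. 0 < p k"
    and increasing: "increasing_objective r p F"
    and no_idle: "\<forall>s'. optimal r p F s' \<longrightarrow> no_idle_time p s'"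
    and opt: "optimal r p F s"
    and distinct: "i \<noteq> j"
    and earlier: "processing_interval s j a b"
    and later: "processing_interval s j c d"
    and order: "b \<le> c"
    and partially: "0 < measure lborel (s i \<inter> {b<..c})"
  shows "s i \<subseteq> {b<..c}"
proof -
  let ?C = "completion_time p s"
  have pos: "0 < p k" for k using p_pos by blast
  note priority = earlier_completing_job_has_priority[OF pos increasing opt]
  have feas: "feasible r p s" using opt unfolding optimal_def by blast
  note ge = completion_time_ge[OF feas pos]
  have ab: "a < b" "{a<..b} \<subseteq> s j" and cd: "c < d" "{c<..d} \<subseteq> s j"
    using earlier later unfolding processing_interval_def by auto
  have "s i \<inter> {b<..c} \<noteq> {}" using partially by (metis measure_empty less_irrefl)
  then obtain t where t: "t \<in> s i" "b < t" "t \<le> c" by auto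
  obtain u where u: "b \<le> u" "u < t" "{u<..t} \<subseteq> s i"
    using feasible_half_open_union[OF feas] t(1,2) by (rule half_open_union_left_neighbourhood)
  have "\<not> ?C j < ?C i"
  proof
    assume "?C j < ?C i"
    moreover have "processing_interval s i u t" using u unfolding processing_interval_def by simp
    moreover have "real (r j) \<le> u" using processing_interval_released[OF feas earlier] ab u by simp
    ultimately have "?C j \<le> u" by (rule priority)
    moreover have "d \<le> ?C j" using cd by (intro ge) auto
    ultimately show False using u t cd by simp
  qed
  with completion_time_neq[OF feas pos pos distinct] have i_first: "?C i < ?C j" by simp
  have Ci: "t \<le> ?C i" using t by (intro ge)
  show ?thesis
  proof
    fix x assume x: "x \<in> s i"
    have "b < x"
    proof (rule ccontr)
      assume "\<not> b < x"
      moreover have "x \<notin> {a<..b}" using x ab feasible_disjoint[OF feas distinct] by blast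
      ultimately have "real (r i) \<le> a" using feasible_released[OF feas x] by auto
      then have "?C i \<le> a" by (rule priority[OF i_first earlier])
      with Ci t ab show False by simp
    qed
    moreover have "x \<le> c"
    proof -
      have "real (r i) \<le> c" using feasible_released[OF feas t(1)] t by simp
      then have "?C i \<le> c" by (rule priority[OF i_first later])
      moreover have "x \<le> ?C i" using x by (intro ge)
      ultimately show ?thesis by simp
    qed
    ultimately show "x \<in> {b<..c}" by simp
  qed
qed

end
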